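(* Fix $m\ge1$ and let $\{a_n\}_{n\ge0}$ be the $m$-gonal sequence. For $n\ge1$, consider the legal $m$-gonal decompositions of all integers $z\in[0,a_{mn+1})$; for a decomposition $z=a_{\ell_t}+\cdots+a_{\ell_1}$ with $\ell_1<\cdots<\ell_t$, its gaps are the multiset $\{\ell_2-\ell_1,\ell_3-\ell_2,\dots,\ell_t-\ell_{t-1}\}$. Let $P_n(g)$ be the fraction, among all gaps (counted with multiplicity) arising from the decompositions of all $z\in[0,a_{mn+1})$, of those of length $g$. Write $g\ge1$ as $g=m\alpha+\beta$ with $\alpha\ge0$ and $0\le\beta<m$. Then $P(g):=\lim_{n\to\infty}P_n(g)$ exists and \[ P(g)=\begin{cases}\dfrac{\beta}{m(m+1)} & \text{if } \alpha=0,\\[2mm] \dfrac{m+1-\beta}{(m+1)^{\alpha+1}} & \text{if } \alpha>0.\end{cases} \]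
   Context: Bins of an increasing sequence $\{a_n\}_{n\ge0}$: $b_0=[a_0]$, $b_k=[a_{m(k-1)+1},\dots,a_{mk}]$ for $k\ge1$. A legal $m$-gonal decomposition of $z$ is $z=a_{\ell_t}+\cdots+a_{\ell_1}$ with $\ell_1<\cdots<\ell_t$ and no two summands in the same bin. The $m$-gonal sequence: each $a_i$ is the smallest positive integer with no legal $m$-gonal decomposition using only $a_0,\dots,a_{i-1}$. Every nonnegative integer has a unique legal $m$-gonal decomposition in terms of this sequence. *)

theory Defs
  imports Complex_Main "HOL-Library.Multiset"
begin

text \<open>Bins and decompositions are represented by index sets: the set \<open>bin m k\<close> holds the indices of
  the terms in \<open>b\<^sub>k\<close>, and \<open>L = {l\<^sub>1 < \<dots> < l\<^sub>t}\<close> stands for \<open>z = a l\<^sub>t + \<dots> + a l\<^sub>1\<close>. The empty set is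
  the decomposition of 0.\<close>

definition bin :: "nat \<Rightarrow> nat \<Rightarrow> nat set" where
  "bin m k = (if k = 0 then {0} else {m * (k - 1) + 1..m * k})"

definition legal_decomp :: "nat \<Rightarrow> (nat \<Rightarrow> nat) \<Rightarrow> nat set \<Rightarrow> nat \<Rightarrow> bool" where
  "legal_decomp m a L z \<longleftrightarrow> finite L \<and> (\<forall>k. card (L \<inter> bin m k) \<le> 1) \<and> z = (\<Sum>l\<in>L. a l)"

lemma legal_decomp_cong [fundef_cong]:
  assumes "m = m'" "L = L'" "z = z'" "\<And>l. l \<in> L' \<Longrightarrow> a l = a' l"
  shows "legal_decomp m a L z = legal_decomp m' a' L' z'"
proof -
  have "(\<Sum>l\<in>L. a l) = (\<Sum>l\<in>L'. a' l)"
    using assms by (intro sum.cong) auto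
  then show ?thesis
    using assms by (simp add: legal_decomp_def)
qed

text \<open>The minimum is always attained: \<open>{..<i}\<close> has only finitely many subsets, so only finitely many
  integers are decomposable.\<close>

function mgonal :: "nat \<Rightarrow> nat \<Rightarrow> nat" where
  "mgonal m i =
    (LEAST z. z > 0 \<and> \<not> (\<exists>L\<in>Pow {..<i}. legal_decomp m (\<lambda>l. mgonal m l) L z))"
  by pat_completeness auto
termination
  by (relation "measure snd") auto

declare mgonal.simps [simp del]

definition gaps :: "nat set \<Rightarrow> nat multiset" where
  "gaps L = (let ls = sorted_list_of_set L in
     {# ls ! Suc i - ls ! i. i \<in># mset_set {..<length ls - 1} #})"

definition all_gaps :: "nat \<Rightarrow> nat \<Rightarrow> nat multiset" where
  "all_gaps m n =
    (\<Sum>z\<in>{0..<mgonal m (m * n + 1)}. \<Sum>L | legal_decomp m (mgonal m) L z. gaps L)"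

definition gap_fraction :: "nat \<Rightarrow> nat \<Rightarrow> nat \<Rightarrow> real" where
  "gap_fraction m n g = real (count (all_gaps m n) g) / real (size (all_gaps m n))"

end

theory Submission
  imports Defs
begin

text \<open>A legal index set with maximum \<open>i\<close> is \<open>{i}\<close> together with an arbitrary legal set below the first
  index of the bin of \<open>i\<close>. This one decomposition gives a recursion for the sequence, the
  bijection between legal sets below \<open>i\<close> and integers below \<open>a i\<close>, and recursions for the
  total number of gaps and for the number of gaps of length \<open>g\<close>. Over one whole bin, and after
  division by \<open>a (m n + 1) = 2 (m + 1) ^ n\<close>, the latter two become (asymptotically) arithmetic
  progressions, and the limit is the quotient of their differences.\<close>

section \<open>Bins and legal index sets\<close>

text \<open>The first index of the bin of \<open>i\<close>. Index 0 has its own case because the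
  formula for positive \<open>i\<close> would give 1.\<close>

definition bin_start :: "nat \<Rightarrow> nat \<Rightarrow> nat" where
  "bin_start m i = (if i = 0 then 0 else m * ((i - 1) div m) + 1)"

definition legal_sets :: "nat \<Rightarrow> nat \<Rightarrow> nat set set" where
  "legal_sets m i = {L. L \<subseteq> {..<i} \<and> (\<forall>k. card (L \<inter> bin m k) \<le> 1)}"

lemma bin_start_0 [simp]: "bin_start m 0 = 0"
  by (simp add: bin_start_def)

lemma bin_start_eq: "r < m \<Longrightarrow> bin_start m (m * q + Suc r) = m * q + 1"
  by (simp add: bin_start_def)

lemma bin_start_le: "bin_start m i \<le> i"
  using times_div_less_eq_dividend[of m "i - 1"] by (cases i) (auto simp: bin_start_def)

text \<open>Together with \<open>same_bin\<close>: up to \<open>i\<close>, the bin of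
  \<open>i\<close> is the interval from \<open>bin_start m i\<close> to \<open>i\<close>, so
  avoiding this bin becomes a bound on the smaller indices.\<close>

lemma bin_start_le_same_bin:
  assumes "i \<in> bin m k" "j \<in> bin m k"
  shows "bin_start m i \<le> j"
proof (cases k)
  case (Suc q)
  then have "i - 1 = m * q + (i - 1 - m * q)" "i - 1 - m * q < m" "m * q < i" "m * q < j"
    using assms by (auto simp: bin_def)
  then show ?thesis
    using bin_start_eq[of "i - 1 - m * q" m q] by auto
qed (use assms in \<open>auto simp: bin_def\<close>)

lemma same_bin:
  assumes "m \<ge> 1" "bin_start m i \<le> j" "j \<le> i"
  obtains k where "i \<in> bin m k" "j \<in> bin m k"
proof (cases "i = 0")
  case True
  then show ?thesis
    using assms that[of 0] by (simp add: bin_def)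
next
  case False
  let ?q = "(i - 1) div m"
  have "i - 1 < m * Suc ?q"
    using dividend_less_times_div[of m "i - 1"] assms by simp
  then show ?thesis
    using assms False that[of "Suc ?q"] by (auto simp: bin_def bin_start_def)
qed

lemma card_le_one_iff: "finite A \<Longrightarrow> card A \<le> 1 \<longleftrightarrow> (\<forall>x\<in>A. \<forall>y\<in>A. x = y)"
  using card_le_Suc0_iff_eq[of A] by simp

lemma finite_bin [simp]: "finite (bin m k)"
  by (simp add: bin_def)

lemma legal_sets_iff:
  "L \<in> legal_sets m i \<longleftrightarrow>
    L \<subseteq> {..<i} \<and> (\<forall>k. \<forall>x\<in>L \<inter> bin m k. \<forall>y\<in>L \<inter> bin m k. x = y)"
  unfolding legal_sets_def by (subst card_le_one_iff) auto

lemma finite_legal_sets [simp]: "finite (legal_sets m i)"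
  by (rule finite_subset[of _ "Pow {..<i}"]) (auto simp: legal_sets_def)

lemma legal_sets_subset: "L \<in> legal_sets m i \<Longrightarrow> L \<subseteq> {..<i}"
  by (simp add: legal_sets_def)

lemma legal_sets_finite: "L \<in> legal_sets m i \<Longrightarrow> finite L"
  by (meson legal_sets_subset finite_lessThan finite_subset)

lemma legal_sets_mono: "i \<le> j \<Longrightarrow> legal_sets m i \<subseteq> legal_sets m j"
  by (auto simp: legal_sets_def)

lemma empty_in_legal_sets [simp]: "{} \<in> legal_sets m i"
  by (simp add: legal_sets_def)

lemma legal_sets_0 [simp]: "legal_sets m 0 = {{}}"
  by (auto simp: legal_sets_def)

lemma insert_legal_sets:
  assumes "L \<in> legal_sets m (bin_start m i)"
  shows "insert i L \<in> legal_sets m (Suc i)"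
proof -
  have "j \<notin> L" if "i \<in> bin m k" "j \<in> bin m k" for j k
    using legal_sets_subset[OF assms] bin_start_le_same_bin[OF that] by auto
  then show ?thesis
    using assms bin_start_le[of m i] by (auto simp: legal_sets_iff)
qed

text \<open>A legal set with maximum \<open>i\<close> has no other index in the bin of
  \<open>i\<close>, so its remaining indices lie below \<open>bin_start m i\<close>.\<close>

lemma legal_sets_Suc:
  assumes "m \<ge> 1"
  shows "legal_sets m (Suc i) = legal_sets m i \<union> insert i ` legal_sets m (bin_start m i)"
proof (intro equalityI subsetI)
  fix L assume L: "L \<in> legal_sets m (Suc i)"
  show "L \<in> legal_sets m i \<union> insert i ` legal_sets m (bin_start m i)"
  proof (cases "i \<in> L")
    case True
    have "j < bin_start m i" if "j \<in> L" "j \<noteq> i" for j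
    proof (rule ccontr)
      assume "\<not> j < bin_start m i"
      moreover have "j \<le> i"
        using that L by (auto simp: legal_sets_iff)
      ultimately obtain k where "i \<in> bin m k" "j \<in> bin m k"
        using same_bin[OF assms, of i j] by (metis not_less)
      then show False
        using L True that by (auto simp: legal_sets_iff)
    qed
    then have "L - {i} \<in> legal_sets m (bin_start m i)"
      using L by (auto simp: legal_sets_iff)
    then show ?thesis
      using True by (metis UnI2 image_eqI insert_Diff)
  next
    case False
    then have "L \<subseteq> {..<i}"
      using legal_sets_subset[OF L] by (auto simp: less_Suc_eq)
    then show ?thesis
      using L by (simp add: legal_sets_def)
  qed
next
  fix L assume "L \<in> legal_sets m i \<union> insert i ` legal_sets m (bin_start m i)"
  then show "L \<in> legal_sets m (Suc i)"
    using insert_legal_sets legal_sets_mono[of i "Suc i" m] by auto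
qed

lemma sum_legal_sets_Suc:
  fixes f :: "nat set \<Rightarrow> 'a::comm_monoid_add"
  assumes "m \<ge> 1"
  shows "sum f (legal_sets m (Suc i)) =
    sum f (legal_sets m i) + (\<Sum>L\<in>legal_sets m (bin_start m i). f (insert i L))"
proof -
  have ni: "i \<notin> L" if "L \<in> legal_sets m j" "j \<le> i" for L j
    using that legal_sets_subset by fastforce
  have "inj_on (insert i) (legal_sets m (bin_start m i))"
    using ni bin_start_le by (meson inj_onI insert_ident)
  moreover have "legal_sets m i \<inter> insert i ` legal_sets m (bin_start m i) = {}"
    using ni[of _ i] by auto
  ultimately show ?thesis
    by (simp add: legal_sets_Suc[OF assms] sum.union_disjoint sum.reindex)
qed

section \<open>The m-gonal sequence and the bijection with integers\<close>

text \<open>When the decomposable integers form an initial segment, the least one missing is its end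
  point.\<close>

lemma mgonal_eqI:
  assumes "sum (mgonal m) ` legal_sets m i = {..<b}" "b > 0"
  shows "mgonal m i = b"
proof -
  have "(\<exists>L\<in>Pow {..<i}. legal_decomp m (mgonal m) L z) \<longleftrightarrow> z < b" for z
  proof -
    have "(\<exists>L\<in>Pow {..<i}. legal_decomp m (mgonal m) L z) \<longleftrightarrow>
      z \<in> sum (mgonal m) ` legal_sets m i"
      by (auto simp: legal_decomp_def legal_sets_def intro: finite_subset)
    then show ?thesis
      using assms by simp
  qed
  then have "mgonal m i = (LEAST z. z > 0 \<and> \<not> z < b)"
    by (subst mgonal.simps) simp
  also have "\<dots> = b"
    by (rule Least_equality) (use assms in auto)
  finally show ?thesis .
qed

text \<open>Sets without \<open>i\<close> fill the interval below \<open>mgonal m i\<close>; sets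
  with \<open>i\<close> have sums shifted by \<open>mgonal m i\<close> and fill the adjacent
  interval.\<close>

lemma bij_betw_legal_sets_step:
  assumes "m \<ge> 1"
    and "bij_betw (sum (mgonal m)) (legal_sets m i) {..<mgonal m i}"
    and "bij_betw (sum (mgonal m)) (legal_sets m (bin_start m i)) {..<mgonal m (bin_start m i)}"
  shows "bij_betw (sum (mgonal m)) (legal_sets m (Suc i))
    {..<mgonal m i + mgonal m (bin_start m i)}"
proof -
  let ?s = "sum (mgonal m)" and ?B = "legal_sets m (bin_start m i)"
  let ?a = "mgonal m i" and ?b = "mgonal m (bin_start m i)"
  have ins: "?s (insert i L) = ?a + ?s L" "i \<notin> L" if "L \<in> ?B" for L
    using legal_sets_subset[OF that] legal_sets_finite[OF that] bin_start_le[of m i]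
    by (fastforce intro: sum.insert)+
  have "bij_betw ((+) ?a) {..<?b} {?a..<?a + ?b}"
    by (simp add: bij_betw_def lessThan_atLeast0 add.commute)
  from bij_betw_trans[OF assms(3) this] have "bij_betw (\<lambda>L. ?a + ?s L) ?B {?a..<?a + ?b}"
    by (simp add: comp_def)
  then have "bij_betw (?s \<circ> insert i) ?B {?a..<?a + ?b}"
    using ins by (subst bij_betw_cong[where g = "\<lambda>L. ?a + ?s L"]) auto
  moreover have "bij_betw (insert i) ?B (insert i ` ?B)"
    by (rule bij_betw_imageI) (use ins in \<open>meson inj_onI insert_ident\<close>, simp)
  ultimately have "bij_betw ?s (insert i ` ?B) {?a..<?a + ?b}"
    using bij_betw_comp_iff by blast
  then have "bij_betw ?s (legal_sets m i \<union> insert i ` ?B) ({..<?a} \<union> {?a..<?a + ?b})"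
    by (intro bij_betw_combine assms(2)) auto
  then show ?thesis
    by (simp add: legal_sets_Suc[OF assms(1)] ivl_disj_un)
qed

lemma mgonal_pos_bij:
  assumes "m \<ge> 1"
  shows "mgonal m i > 0 \<and> bij_betw (sum (mgonal m)) (legal_sets m i) {..<mgonal m i}"
proof (induction i rule: less_induct)
  case (less i)
  show ?case
  proof (cases i)
    case 0
    have "mgonal m 0 = 1"
      by (rule mgonal_eqI) auto
    then show ?thesis
      using 0 by (auto simp: bij_betw_def)
  next
    case (Suc j)
    have "bin_start m j < i"
      using bin_start_le[of m j] Suc by simp
    then have "bij_betw (sum (mgonal m)) (legal_sets m i) {..<mgonal m j + mgonal m (bin_start m j)}"
      using bij_betw_legal_sets_step[OF assms] less Suc by simp
    \<comment> \<open>The image just found is an initial segment, so its end is the next term;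
      recursion and bijection thus come out of one induction.\<close>
    moreover from this have "mgonal m i = mgonal m j + mgonal m (bin_start m j)"
      using less[of j] Suc by (intro mgonal_eqI) (auto simp: bij_betw_def)
    ultimately show ?thesis
      using less[of j] Suc by simp
  qed
qed

lemmas mgonal_pos = mgonal_pos_bij[THEN conjunct1]
  and bij_betw_legal_sets = mgonal_pos_bij[THEN conjunct2]

lemma card_legal_sets: "m \<ge> 1 \<Longrightarrow> card (legal_sets m i) = mgonal m i"
  using bij_betw_same_card[OF bij_betw_legal_sets] by simp

lemma mgonal_Suc:
  assumes "m \<ge> 1"
  shows "mgonal m (Suc i) = mgonal m i + mgonal m (bin_start m i)"
  using bij_betw_same_card[OF bij_betw_legal_sets_step[OF assms bij_betw_legal_sets[OF assms]
        bij_betw_legal_sets[OF assms]], of i]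
  by (simp add: card_legal_sets[OF assms])

lemma mgonal_mono: "m \<ge> 1 \<Longrightarrow> i \<le> j \<Longrightarrow> mgonal m i \<le> mgonal m j"
  using lift_Suc_mono_le[of "mgonal m" i j] by (simp add: mgonal_Suc)

text \<open>All indices of a bin share the start \<open>m * n + 1\<close>, so each of the
  \<open>m\<close> steps adds another copy of \<open>f (m * n + 1)\<close>. The same argument serves
  the sequence, the number of all gaps and the number of gaps of length \<open>g\<close>, with
  \<open>d\<close> as the contribution of the new gaps.\<close>

lemma bin_recursion:
  fixes f :: "nat \<Rightarrow> 'a::comm_semiring_1"
  assumes "\<And>i. f (Suc i) = f i + f (bin_start m i) + d i"
  shows "f (m * Suc n + 1) = of_nat (m + 1) * f (m * n + 1) + (\<Sum>r<m. d (m * n + Suc r))"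
proof -
  have "f (m * n + 1 + p) = of_nat (p + 1) * f (m * n + 1) + (\<Sum>r<p. d (m * n + Suc r))"
    if "p \<le> m" for p
    using that
  proof (induction p)
    case (Suc p)
    then show ?case
      using assms[of "m * n + Suc p"] bin_start_eq[of p m n] by (simp add: algebra_simps)
  qed simp
  from this[of m] show ?thesis
    by (simp add: algebra_simps)
qed

lemma mgonal_bin_start:
  assumes "m \<ge> 1"
  shows "mgonal m (m * n + 1) = 2 * (m + 1) ^ n"
proof (induction n)
  case 0
  have "mgonal m 0 = 1"
    by (rule mgonal_eqI) auto
  then show ?case
    using mgonal_Suc[OF assms, of 0] by simp
next
  case (Suc n)
  then show ?case
    using bin_recursion[where f = "mgonal m" and d = "\<lambda>_. 0" and m = m and n = n]
      mgonal_Suc[OF assms] by (simp del: One_nat_def add_Suc_right mult_Suc_right)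
qed

section \<open>Gaps and their recursion\<close>

text \<open>By monotonicity of the sequence, a decomposition of
  \<open>z < mgonal m (m * n + 1)\<close> uses no index from \<open>m * n + 1\<close> on. Summing
  over \<open>z\<close> then only groups the legal sets by their value.\<close>

lemma all_gaps_eq:
  assumes "m \<ge> 1"
  shows "all_gaps m n = sum gaps (legal_sets m (m * n + 1))"
proof -
  let ?N = "m * n + 1"
  have "{L. legal_decomp m (mgonal m) L z} = {L \<in> legal_sets m ?N. sum (mgonal m) L = z}"
    if "z < mgonal m ?N" for z
  proof -
    have "L \<subseteq> {..<?N}" if L: "legal_decomp m (mgonal m) L z" for L
    proof (rule ccontr)
      assume "\<not> L \<subseteq> {..<?N}"
      then obtain i where i: "i \<in> L" "?N \<le> i"
        by (meson lessThan_iff not_less subsetI)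
      then have "mgonal m i \<le> z"
        using L member_le_sum[of i L "mgonal m"] by (simp add: legal_decomp_def)
      then show False
        using mgonal_mono[OF assms i(2)] \<open>z < mgonal m ?N\<close> by simp
    qed
    then show ?thesis
      by (auto simp: legal_decomp_def legal_sets_def intro: finite_subset)
  qed
  then have "all_gaps m n =
    (\<Sum>z\<in>{0..<mgonal m ?N}. \<Sum>L | L \<in> legal_sets m ?N \<and> sum (mgonal m) L = z. gaps L)"
    unfolding all_gaps_def by (intro sum.cong) auto
  also have "\<dots> = sum gaps (legal_sets m ?N)"
    using bij_betw_legal_sets[OF assms, of ?N]
    by (intro sum.group) (auto simp: bij_betw_def)
  finally show ?thesis .
qed

text \<open>A new maximum goes to the end of the sorted list: the old gaps stay, and only the
  distance to the old maximum is new.\<close>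

lemma gaps_insert:
  assumes "finite L" "\<And>x. x \<in> L \<Longrightarrow> x < i"
  shows "gaps (insert i L) = gaps L + (if L = {} then {#} else {#i - Max L#})"
proof (cases "L = {}")
  case False
  define ls where "ls = sorted_list_of_set L"
  have set: "set ls = L" and "sorted ls" "distinct ls"
    using assms by (simp_all add: ls_def)
  have ins: "sorted_list_of_set (insert i L) = ls @ [i]"
    using assms set \<open>sorted ls\<close> \<open>distinct ls\<close>
    by (intro sorted_distinct_set_unique sorted_sorted_list_of_set distinct_sorted_list_of_set)
      (auto simp: sorted_append less_imp_le simp del: sorted_list_of_set_insert_remove)
  have "ls \<noteq> []"
    using set False by auto
  then obtain k where k: "length ls = Suc k"
    by (cases ls) auto
  have "Max L = ls ! k"
  proof (rule Max_eqI[OF assms(1)])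
    show "ls ! k \<in> L"
      using k set by (metis lessI nth_mem)
    show "y \<le> ls ! k" if "y \<in> L" for y
      using that k set \<open>sorted ls\<close> by (metis in_set_conv_nth less_Suc_eq_le lessI sorted_nth_mono)
  qed
  moreover have "image_mset (\<lambda>j. (ls @ [i]) ! Suc j - (ls @ [i]) ! j) (mset_set {..<k}) =
    image_mset (\<lambda>j. ls ! Suc j - ls ! j) (mset_set {..<k})"
    by (intro image_mset_cong) (simp add: nth_append k)
  ultimately show ?thesis
    using False by (simp add: gaps_def Let_def ins ls_def[symmetric] k lessThan_Suc nth_append)
qed (simp add: gaps_def)

text \<open>The shape needed for \<open>bin_recursion\<close>, whose \<open>d\<close> comes from the
  last sum. The empty set is left out there because \<open>{i}\<close> has no gap.\<close>

lemma gap_sum_Suc: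
  assumes "m \<ge> 1"
  shows "sum gaps (legal_sets m (Suc i)) =
    sum gaps (legal_sets m i) + sum gaps (legal_sets m (bin_start m i)) +
    (\<Sum>L\<in>legal_sets m (bin_start m i) - {{}}. {#i - Max L#})"
proof -
  let ?B = "legal_sets m (bin_start m i)"
  have "gaps (insert i L) = gaps L + (if L = {} then {#} else {#i - Max L#})"
    if "L \<in> ?B" for L
    using legal_sets_subset[OF that] bin_start_le[of m i] legal_sets_finite[OF that]
    by (intro gaps_insert) auto
  then have "(\<Sum>L\<in>?B. gaps (insert i L)) =
    sum gaps ?B + (\<Sum>L\<in>?B. if L = {} then {#} else {#i - Max L#})"
    by (simp add: sum.distrib)
  also have "(\<Sum>L\<in>?B. if L = {} then {#} else {#i - Max L#}) =
    (\<Sum>L\<in>?B - {{}}. {#i - Max L#})"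
    by (intro sum.mono_neutral_cong_right) auto
  finally show ?thesis
    by (simp add: sum_legal_sets_Suc[OF assms] ac_simps)
qed

lemma card_legal_sets_Max:
  assumes "m \<ge> 1" "x < i"
  shows "card {L \<in> legal_sets m i. L \<noteq> {} \<and> Max L = x} = mgonal m (bin_start m x)"
proof -
  have ni: "x \<notin> L" if "L \<in> legal_sets m (bin_start m x)" for L
    using legal_sets_subset[OF that] bin_start_le[of m x] by auto
  have Max_insert_x: "Max (insert x L) = x" if "L \<in> legal_sets m (bin_start m x)" for L
    using legal_sets_subset[OF that] bin_start_le[of m x] legal_sets_finite[OF that]
    by (intro Max_eqI) auto
  have "{L \<in> legal_sets m i. L \<noteq> {} \<and> Max L = x} = insert x ` legal_sets m (bin_start m x)"
  proof (intro equalityI subsetI)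
    fix L assume L: "L \<in> {L \<in> legal_sets m i. L \<noteq> {} \<and> Max L = x}"
    then have "finite L"
      using legal_sets_finite by blast
    then have "x \<in> L" "L \<subseteq> {..<Suc x}"
      using L Max_in[of L] Max_ge[of L] by (auto simp: less_Suc_eq_le)
    \<comment> \<open>Legal below \<open>Suc x\<close> but not below \<open>x\<close>: only the
      second half of the union in \<open>legal_sets_Suc\<close> remains.\<close>
    then have "L \<in> legal_sets m (Suc x)" "L \<notin> legal_sets m x"
      using L by (auto simp: legal_sets_def)
    then show "L \<in> insert x ` legal_sets m (bin_start m x)"
      by (simp add: legal_sets_Suc[OF assms(1)])
  next
    fix L assume "L \<in> insert x ` legal_sets m (bin_start m x)"
    then show "L \<in> {L \<in> legal_sets m i. L \<noteq> {} \<and> Max L = x}"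
      using insert_legal_sets legal_sets_mono[of "Suc x" i m] assms Max_insert_x by auto
  qed
  moreover have "inj_on (insert x) (legal_sets m (bin_start m x))"
    using ni by (meson inj_onI insert_ident)
  ultimately show ?thesis
    by (simp add: card_image card_legal_sets[OF assms(1)])
qed

text \<open>A new gap has length \<open>g\<close> exactly when \<open>Max L = i - g\<close>, and
  this maximum must precede the bin of \<open>i\<close>. The test \<open>g \<le> i\<close> guards
  against truncated subtraction.\<close>

lemma count_new_gaps:
  assumes "m \<ge> 1" "g \<ge> 1"
  shows "count (\<Sum>L\<in>legal_sets m (bin_start m i) - {{}}. {#i - Max L#}) g =
    (if g \<le> i \<and> i - g < bin_start m i then mgonal m (bin_start m (i - g)) else 0)"
proof -
  let ?B = "legal_sets m (bin_start m i)"
  have Max_less: "Max L < bin_start m i" if "L \<in> ?B" "L \<noteq> {}" for L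
    using legal_sets_subset[OF that(1)] legal_sets_finite[OF that(1)] that by auto
  have "count (\<Sum>L\<in>?B - {{}}. {#i - Max L#}) g = card {L \<in> ?B - {{}}. i - Max L = g}"
    by (simp add: count_sum sum.If_cases Int_def)
  also have "{L \<in> ?B - {{}}. i - Max L = g} =
    (if g \<le> i \<and> i - g < bin_start m i then {L \<in> ?B. L \<noteq> {} \<and> Max L = i - g} else {})"
  proof (intro set_eqI iffI)
    fix L assume "L \<in> {L \<in> ?B - {{}}. i - Max L = g}"
    then show "L \<in> (if g \<le> i \<and> i - g < bin_start m i
        then {L \<in> ?B. L \<noteq> {} \<and> Max L = i - g} else {})"
      using Max_less[of L] bin_start_le[of m i] by auto
  qed (auto split: if_splits)
  finally show ?thesis
    using card_legal_sets_Max[OF assms(1)] by simp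
qed

section \<open>Gap counts over whole bins\<close>

lemma size_new_gaps:
  assumes "m \<ge> 1"
  shows "size (\<Sum>L\<in>legal_sets m i - {{}}. {#j - Max L#}) = mgonal m i - 1"
  by (simp add: card_legal_sets[OF assms])

text \<open>With \<open>M = m + 1\<close> the recursion is
  \<open>s (n + 1) = M * s n + m * (2 * M ^ n - 1)\<close>. The forcing \<open>2 * m * M ^ n\<close>
  resonates with the factor \<open>M\<close> and yields the term linear in \<open>n\<close>; the
  forcing \<open>- m\<close> has the constant solution 1; \<open>s 0 = 0\<close> gives the
  \<open>- 1 / 2\<close>.\<close>

lemma size_all_gaps:
  assumes "m \<ge> 1"
  shows "real (size (all_gaps m n)) =
    2 * (real m + 1) ^ n * (real n * (real m / (real m + 1)) - 1 / 2) + 1"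
proof (induction n)
  case 0
  have "legal_sets m (Suc 0) = {{}, {0}}"
    by (auto simp: legal_sets_Suc[OF assms])
  then show ?case
    by (simp add: all_gaps_eq[OF assms] gaps_def)
next
  case (Suc n)
  let ?f = "\<lambda>i. real (size (sum gaps (legal_sets m i)))"
  have "?f (m * Suc n + 1) =
    of_nat (m + 1) * ?f (m * n + 1) + (\<Sum>r<m. real (mgonal m (bin_start m (m * n + Suc r)) - 1))"
    by (rule bin_recursion)
      (simp only: gap_sum_Suc[OF assms] size_union size_new_gaps[OF assms] of_nat_add)
  also have "(\<Sum>r<m. real (mgonal m (bin_start m (m * n + Suc r)) - 1)) =
    (\<Sum>r<m. 2 * (real m + 1) ^ n - 1)"
  proof (rule sum.cong[OF refl])
    fix r assume "r \<in> {..<m}"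
    then have "bin_start m (m * n + Suc r) = m * n + 1"
      using bin_start_eq by auto
    then show "real (mgonal m (bin_start m (m * n + Suc r)) - 1) = 2 * (real m + 1) ^ n - 1"
      using mgonal_bin_start[OF assms, of n] mgonal_pos[OF assms, of "m * n + 1"]
      by (simp add: of_nat_diff Suc_leI add.commute)
  qed
  finally have "real (size (all_gaps m (Suc n))) =
    (real m + 1) * real (size (all_gaps m n)) + real m * (2 * (real m + 1) ^ n - 1)"
    unfolding all_gaps_eq[OF assms] by (simp del: size_multiset_sum)
  also have "\<dots> = 2 * (real m + 1) ^ Suc n * (real (Suc n) * (real m / (real m + 1)) - 1 / 2) + 1"
  proof -
    \<comment> \<open>Replacing \<open>m\<close> by \<open>M * q\<close> makes the identity
      polynomial, up to \<open>M - M * q = 1\<close>.\<close>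
    define M where "M = real m + 1"
    define q where "q = real m / M"
    have q: "real m = M * q" "M - M * q = 1"
      by (simp_all add: M_def q_def)
    have "M * (2 * M ^ n * (real n * q - 1 / 2) + 1) + M * q * (2 * M ^ n - 1) =
      2 * M ^ Suc n * (real (Suc n) * q - 1 / 2) + (M - M * q)"
      by (simp add: algebra_simps)
    then show ?thesis
      unfolding Suc M_def[symmetric] q_def[symmetric] by (simp only: q)
  qed
  finally show ?case .
qed

text \<open>For \<open>i = m * n + Suc r\<close>, the index \<open>i - g\<close> lies
  \<open>\<alpha> + 1\<close> bins back if \<open>r < \<beta>\<close> and \<open>\<alpha>\<close>
  bins back otherwise. The bound \<open>\<alpha> < n\<close> keeps it positive.\<close>

lemma count_all_gaps_Suc:
  fixes m g \<alpha> \<beta> :: nat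
  assumes "m \<ge> 1" "g \<ge> 1" "g = m * \<alpha> + \<beta>" "\<beta> < m" "\<alpha> < n"
  shows "count (all_gaps m (Suc n)) g = (m + 1) * count (all_gaps m n) g +
    2 * (m + 1) ^ (n - \<alpha> - 1) * ((if \<alpha> = 0 then 0 else (m - \<beta>) * (m + 1)) + \<beta>)"
proof -
  let ?d = "\<lambda>i. if g \<le> i \<and> i - g < bin_start m i then mgonal m (bin_start m (i - g)) else 0"
  \<comment> \<open>\<open>v\<close> and \<open>u\<close> are the numbers of new gaps in these two
    cases, that is, the sequence at the start of the bin of \<open>i - g\<close>. For
    \<open>\<alpha> = 0\<close> the second case stays in the bin of \<open>i\<close>, which is
    forbidden.\<close>
  define u where "u = (if \<alpha> = 0 then 0 else 2 * (m + 1) ^ (n - \<alpha>))"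
  define v where "v = 2 * (m + 1) ^ (n - \<alpha> - 1)"
  obtain c where c: "n = Suc (\<alpha> + c)"
    using assms(5) less_imp_Suc_add by blast
  have d: "?d (m * n + Suc r) = (if r < \<beta> then v else u)" if "r < m" for r
  proof (cases "r < \<beta>")
    case True
    \<comment> \<open>Here subtracting \<open>\<beta>\<close> borrows one more block of
      \<open>m\<close> indices.\<close>
    then have "m * n + Suc r - g = m * c + Suc (m + r - \<beta>)" "m + r - \<beta> < m"
      using assms by (auto simp: c algebra_simps)
    then show ?thesis
      using True that assms(1,3,4) bin_start_eq[of "m + r - \<beta>" m c] bin_start_eq[OF that, of n]
        mgonal_bin_start[OF assms(1), of c]
      by (auto simp: v_def c algebra_simps)
  next
    case False
    then have "m * n + Suc r - g = m * Suc c + Suc (r - \<beta>)" "r - \<beta> < m"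
      using assms that by (auto simp: c algebra_simps)
    moreover have "m * Suc c + Suc (r - \<beta>) < m * n + 1 \<longleftrightarrow> \<alpha> \<noteq> 0"
    proof (cases \<alpha>)
      case (Suc a)
      then show ?thesis
        using that False assms(1) by (simp add: c algebra_simps less_imp_diff_less trans_less_add1)
    qed (simp add: c)
    ultimately show ?thesis
      using False that assms(1,3,4) bin_start_eq[of "r - \<beta>" m "Suc c"] bin_start_eq[OF that, of n]
        mgonal_bin_start[OF assms(1), of "Suc c"]
      by (auto simp: u_def c algebra_simps)
  qed
  have "count (all_gaps m (Suc n)) g =
    of_nat (m + 1) * count (all_gaps m n) g + (\<Sum>r<m. ?d (m * n + Suc r))"
    unfolding all_gaps_eq[OF assms(1)]
    by (rule bin_recursion)
      (simp only: gap_sum_Suc[OF assms(1)] count_union count_new_gaps[OF assms(1,2)])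
  also have "(\<Sum>r<m. ?d (m * n + Suc r)) = (\<Sum>r<m. if r < \<beta> then v else u)"
    by (intro sum.cong refl d) auto
  also have "\<dots> = \<beta> * v + (m - \<beta>) * u"
  proof -
    have "{..<m} \<inter> {r. r < \<beta>} = {..<\<beta>}" "{..<m} \<inter> - {r. r < \<beta>} = {\<beta>..<m}"
      using assms(4) by auto
    then show ?thesis
      by (simp add: sum.If_cases)
  qed
  finally show ?thesis
    by (simp add: u_def v_def c algebra_simps)
qed

section \<open>Passage to the limit\<close>

lemma tendsto_divide_n_if_eventually_arithmetic:
  fixes x :: "nat \<Rightarrow> real"
  assumes "\<And>n. n \<ge> N \<Longrightarrow> x (Suc n) = x n + d"
  shows "(\<lambda>n. x n / real n) \<longlonglongrightarrow> d"
proof -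
  have x: "x n = x N + (real n - real N) * d" if "n \<ge> N" for n
    using that by (induction n rule: dec_induct) (auto simp: assms algebra_simps)
  have "(\<lambda>n. (x N - real N * d) / real n + d) \<longlonglongrightarrow> 0 + d"
    by (intro tendsto_intros lim_const_over_n)
  moreover have "eventually (\<lambda>n. (x N - real N * d) / real n + d = x n / real n) sequentially"
    using eventually_ge_at_top[of "Suc N"]
  proof eventually_elim
    case (elim n)
    then have "x n / real n = (x N + (real n - real N) * d) / real n"
      using x[of n] by simp
    also have "\<dots> = (x N - real N * d) / real n + d"
      using elim by (simp add: field_simps)
    finally show ?case
      by (rule sym)
  qed
  ultimately show ?thesis
    by (simp add: tendsto_cong)
qed

theorem theorem1p7:
  fixes m g \<alpha> \<beta> :: nat
  assumes "m \<ge> 1"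
    and "g \<ge> 1"
    and "g = m * \<alpha> + \<beta>"
    and "\<beta> < m"
  shows "(\<lambda>n. gap_fraction m n g) \<longlonglongrightarrow>
    (if \<alpha> = 0 then real \<beta> / (real m * (real m + 1))
     else (real m + 1 - real \<beta>) / (real m + 1) ^ (\<alpha> + 1))"
proof -
  define M where "M = real m + 1"
  \<comment> \<open>\<open>w\<close> is the bracket in \<open>count_all_gaps_Suc\<close>. Dividing
    that recursion by \<open>2 * M ^ (n + 1)\<close> removes the factor \<open>M\<close> and leaves
    the constant increment \<open>w / M ^ (\<alpha> + 2)\<close>.\<close>
  define w where "w = (if \<alpha> = 0 then 0 else (real m - real \<beta>) * M) + real \<beta>"
  define x where "x n = real (count (all_gaps m n) g) / (2 * M ^ n)" for n
  define y where "y n = real (size (all_gaps m n)) / (2 * M ^ n)" for n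
  have M: "M > 1"
    using assms(1) by (auto simp: M_def)
  have M': "M = real (m + 1)"
    by (simp add: M_def)
  have w: "w = real ((if \<alpha> = 0 then 0 else (m - \<beta>) * (m + 1)) + \<beta>)"
    using of_nat_diff[OF less_imp_le[OF assms(4)], where 'a = real]
    by (simp only: w_def M' of_nat_add of_nat_mult of_nat_0 if_distrib[of real])
  have "x (Suc n) = x n + w / M ^ (\<alpha> + 2)" if "n \<ge> Suc \<alpha>" for n
  proof -
    obtain c where c: "n = Suc (\<alpha> + c)"
      using \<open>n \<ge> Suc \<alpha>\<close> less_imp_Suc_add by (metis Suc_le_lessD)
    have "real (count (all_gaps m (Suc n)) g) =
      M * real (count (all_gaps m n) g) + 2 * M ^ (n - \<alpha> - 1) * w"
      unfolding w M' count_all_gaps_Suc[OF assms Suc_le_lessD[OF that]]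
      by (simp only: of_nat_add of_nat_mult of_nat_power of_nat_numeral)
    then show ?thesis
      using M by (simp add: x_def c field_simps power_add)
  qed
  then have "(\<lambda>n. x n / real n) \<longlonglongrightarrow> w / M ^ (\<alpha> + 2)"
    by (rule tendsto_divide_n_if_eventually_arithmetic)
  moreover have "(\<lambda>n. y n / real n) \<longlonglongrightarrow> real m / M"
  \<comment> \<open>\<open>y\<close> is arithmetic only up to the vanishing term
    \<open>inverse M ^ n / 2\<close>, which stems from the \<open>+ 1\<close> in
    \<open>size_all_gaps\<close> and is split off.\<close>
  proof -
    have "(\<lambda>n. (real n * (real m / M) - 1 / 2) / real n) \<longlonglongrightarrow> real m / M"
      by (rule tendsto_divide_n_if_eventually_arithmetic[of 0]) (simp add: algebra_simps add_divide_distrib)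
    moreover have "(\<lambda>n. inverse M ^ n / 2 * (1 / real n)) \<longlonglongrightarrow> 0 / 2 * 0"
      using M by (intro tendsto_intros LIMSEQ_power_zero lim_const_over_n) (auto simp: field_simps)
    ultimately have "(\<lambda>n. (real n * (real m / M) - 1 / 2) / real n + inverse M ^ n / 2 * (1 / real n))
      \<longlonglongrightarrow> real m / M + 0 / 2 * 0"
      by (rule tendsto_add)
    moreover have "y n = real n * (real m / M) - 1 / 2 + inverse M ^ n / 2" for n
    proof -
      have "y n = (2 * M ^ n * (real n * (real m / M) - 1 / 2) + 1) / (2 * M ^ n)"
        unfolding y_def size_all_gaps[OF assms(1)] M_def ..
      also have "\<dots> = real n * (real m / M) - 1 / 2 + 1 / (2 * M ^ n)"
        using M by (subst add_divide_distrib) simp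
      finally show ?thesis
        by (simp add: inverse_eq_divide power_one_over)
    qed
    ultimately show ?thesis
      by (simp add: add_divide_distrib)
  qed
  moreover have "real m / M \<noteq> 0"
    using assms(1) M by simp
  ultimately have "(\<lambda>n. (x n / real n) / (y n / real n)) \<longlonglongrightarrow> w / M ^ (\<alpha> + 2) / (real m / M)"
    by (rule tendsto_divide)
  moreover have "eventually (\<lambda>n. (x n / real n) / (y n / real n) = gap_fraction m n g) sequentially"
    using eventually_gt_at_top[of 0]
    by eventually_elim (use M in \<open>simp add: x_def y_def gap_fraction_def\<close>)
  ultimately have "(\<lambda>n. gap_fraction m n g) \<longlonglongrightarrow> w / M ^ (\<alpha> + 2) / (real m / M)"
    by (simp add: tendsto_cong)
  also have "w / M ^ (\<alpha> + 2) / (real m / M) =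
    (if \<alpha> = 0 then real \<beta> / (real m * M) else (M - real \<beta>) / M ^ (\<alpha> + 1))"
  proof (cases "\<alpha> = 0")
    case False
    \<comment> \<open>\<open>(m - \<beta>) * (m + 1) + \<beta> = m * (m + 1 - \<beta>)\<close>, so
      the factor \<open>m\<close> cancels against the limit of \<open>y n / n\<close>.\<close>
    then have "w = real m * (M - real \<beta>)"
      by (simp add: w_def M_def algebra_simps)
    then show ?thesis
      using False M assms(1) by simp
  qed (use M in \<open>simp add: w_def\<close>)
  finally show ?thesis
    unfolding M_def .
qed

end
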